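(* For any integers $0<r<k<n$ and $r<h<n$ the following formula holds: $$u_{r,k,h,n}(t) = p_{r,k,h,n}(t) - p'_{r,h}(t)\cdot p'_{k-r,n-h}(t)\cdot(1+t) + \sum_{i = r+1}^k \binom{h}{i}\binom{n-h}{k-i},$$ where $p'_{r,h}(t) =f_{\Delta_{r,h}}(t)-\binom{h}{r}$ and $$p_{r,k,h,n}(t) = \sum_{j=0}^{h-r-1} \ \sum_{i=0}^{\min\{h-j,k-1\}} \ \sum_{\ell = 0}^{\min\{k-i-1,k-r-1\}} \ \sum_{m=0}^{\min\{n-h-\ell,n-k-j-1\}} \binom{h}{i,j}\binom{n-h}{\ell,m} \cdot t^{n-1-i-j-\ell-m}.$$
   Context: For a $d$-dimensional polytope $\mathscr{P}$, $f_{\mathscr{P}}(t)=\sum_{i=0}^d f_i t^i$, where $f_i$ is the number of $i$-dimensional faces of $\mathscr{P}$ (the empty face is not counted, $f_d=1$; so the polynomial of an empty polytope is $0$). The hypersimplex is $\Delta_{k,n}=\{x\in[0,1]^n : \sum_{i=1}^n x_i=k\}$. Define $$u_{r,k,h,n}(t):=f_{\Delta_{k,n}}(t)-f_{\mathscr{P}(\mathsf{\Lambda}_{k-r,k,n-h,n})}(t),\qquad \mathscr{P}(\mathsf{\Lambda}_{k-r,k,n-h,n})=\Big\{x\in\Delta_{k,n} : \sum_{i=1}^h x_i\le r\Big\};$$ the latter is the base polytope (convex hull of indicator vectors of bases) of the so-called Schubert elementary split matroid $\mathsf{\Lambda}_{k-r,k,n-h,n}$. Multinomial coefficients: for nonnegative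 integers $i,j,\ell$, $\binom{i+j+\ell}{i,j}:=\frac{(i+j+\ell)!}{i!\,j!\,\ell!}$. Sums whose upper limit is smaller than the lower limit are empty. *)

theory Defs
  imports "HOL-Analysis.Analysis" "HOL-Computational_Algebra.Polynomial"
begin

(* The empty face has aff_dim -1 and is thus not counted; for P = {} the only summand is i = 0,
   and its coefficient is 0. *)
definition f_poly :: "'a::euclidean_space set \<Rightarrow> int poly" where
  "f_poly P = (\<Sum>i = 0..nat (aff_dim P).
     monom (int (card {F. F face_of P \<and> aff_dim F = int i})) i)"

(* Delta_{k,n}, where n is the cardinality of the index type. *)
definition hypersimplex :: "nat \<Rightarrow> (real ^ 'n) set" where
  "hypersimplex k = {x. (\<forall>i. 0 \<le> x $ i \<and> x $ i \<le> 1) \<and> (\<Sum>i\<in>UNIV. x $ i) = real k}"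

(* The coordinates x_1, ..., x_n of x are x $ e 1, ..., x $ e n for an enumeration e of the
   index type, i.e. bij_betw e {1..CARD('n)} UNIV. *)
definition schubert_split_polytope ::
    "(nat \<Rightarrow> 'n) \<Rightarrow> nat \<Rightarrow> nat \<Rightarrow> nat \<Rightarrow> (real ^ 'n) set" where
  "schubert_split_polytope e r k h = {x \<in> hypersimplex k. (\<Sum>i = 1..h. x $ e i) \<le> real r}"

definition u_poly :: "(nat \<Rightarrow> 'n::finite) \<Rightarrow> nat \<Rightarrow> nat \<Rightarrow> nat \<Rightarrow> int poly" where
  "u_poly e r k h =
     f_poly (hypersimplex k :: (real ^ 'n) set) - f_poly (schubert_split_polytope e r k h)"

(* p'_{r,h} with h = CARD('h). *)
definition p'_poly :: "'h::finite itself \<Rightarrow> nat \<Rightarrow> int poly" where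
  "p'_poly _ r = f_poly (hypersimplex r :: (real ^ 'h) set) - of_nat (CARD('h) choose r)"

(* The multinomial coefficient N! / (i! j! (N - i - j)!), meaningful for i + j <= N only. *)
definition multinom :: "nat \<Rightarrow> nat \<Rightarrow> nat \<Rightarrow> nat" where
  "multinom N i j = fact N div (fact i * fact j * fact (N - i - j))"

(* The range 0, ..., z of a summation index; empty when the upper limit z is negative. *)
definition up_to :: "int \<Rightarrow> nat set" where
  "up_to z = {i. int i \<le> z}"

(* All exponents n-1-i-j-l-m occurring here are positive, since i + l <= k - 1 and
   j + m <= n - k - 1; likewise i + j <= h and l + m <= n - h. *)
definition p_poly :: "nat \<Rightarrow> nat \<Rightarrow> nat \<Rightarrow> nat \<Rightarrow> int poly" where
  "p_poly r k h n =
     (\<Sum>j\<in>up_to (int h - int r - 1).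
      \<Sum>i\<in>up_to (min (int h - int j) (int k - 1)).
      \<Sum>l\<in>up_to (min (int k - int i - 1) (int k - int r - 1)).
      \<Sum>m\<in>up_to (min (int n - int h - int l) (int n - int k - int j - 1)).
        monom (int (multinom h i j * multinom (n - h) l m)) (n - 1 - i - j - l - m))"

end

theory Submission
  imports Defs
begin

text \<open>
  A polyhedron is partitioned by the set of inequalities that are tight at a point; the parts
  (cells) are the relative interiors of the nonempty faces. Intersecting with a half-space
  \<open>c \<bullet> x \<le> d\<close> replaces every cell \<open>C\<close> by its nonempty parts in \<open>c \<bullet> x < d\<close> and in \<open>c \<bullet> x = d\<close>.
  Since \<open>C\<close> is convex and relatively open, it either lies on one side of the hyperplane or inside it,
  or it meets both open sides. Hence the \<open>f\<close>-polynomial drops by \<open>t ^ dim C\<close> for every cell having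
  a point with \<open>c \<bullet> x > d\<close>, and \<open>t ^ dim C + t ^ (dim C - 1)\<close> is given back for the crossing cells.

  A cell of the hypersimplex is given by the sets \<open>A\<close>, \<open>B\<close> of coordinates equal to \<open>1\<close> and \<open>0\<close>.
  With \<open>S\<close> the first \<open>h\<close> coordinates and \<open>i = |A \<inter> S|\<close>, \<open>j = |B \<inter> S|\<close>, \<open>l = |A - S|\<close>, \<open>m = |B - S|\<close>,
  a cell that is not a vertex exceeds the bound iff \<open>j < h - r\<close> and \<open>l < k - r\<close>, which gives \<open>p\<close>,
  and it crosses the hyperplane iff \<open>(A \<inter> S, B \<inter> S)\<close> and \<open>(A - S, B - S)\<close> are themselves non-vertex
  cells of \<open>\<Delta>\<^bsub>r,h\<^esub>\<close> and \<open>\<Delta>\<^bsub>k-r,n-h\<^esub>\<close>, which gives the product \<open>p' p' (1 + t)\<close>.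
\<close>

section \<open>Faces and cells of a polyhedron\<close>

text \<open>Grouping the faces by dimension turns the coefficients of \<open>f_poly\<close> into a
  sum over single faces. Only the empty face has negative \<open>aff_dim\<close>, so
  \<open>nat\<close> loses nothing on the others; finiteness keeps the sum from collapsing to the
  default value 0.\<close>

lemma f_poly_eq_sum_faces:
  assumes "finite {F. F face_of P}"
  shows "f_poly P = (\<Sum>F\<in>{F. F face_of P \<and> F \<noteq> {}}. monom 1 (nat (aff_dim F)))"
proof -
  let ?S = "{F. F face_of P \<and> F \<noteq> {}}"
  have fin: "finite ?S" by (rule finite_subset[OF _ assms]) auto
  have "f_poly P = (\<Sum>i\<in>{0..nat (aff_dim P)}. \<Sum>F\<in>{F. F \<in> ?S \<and> nat (aff_dim F) = i}. monom 1 (nat (aff_dim F)))"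
    unfolding f_poly_def
  proof (rule sum.cong[OF refl])
    fix i
    have "F \<noteq> {} \<longleftrightarrow> 0 \<le> aff_dim F" for F :: "'a set"
      using aff_dim_geq[of F] aff_dim_empty[of F] by linarith
    then have "aff_dim F = int i \<longleftrightarrow> F \<noteq> {} \<and> nat (aff_dim F) = i" for F :: "'a set"
      by (metis int_nat_eq nat_int of_nat_0_le_iff)
    then have "{F. F face_of P \<and> aff_dim F = int i} = {F. F \<in> ?S \<and> nat (aff_dim F) = i}"
      by blast
    moreover have "(\<Sum>F\<in>{F. F \<in> ?S \<and> nat (aff_dim F) = i}. monom 1 (nat (aff_dim F)))
        = (\<Sum>F\<in>{F. F \<in> ?S \<and> nat (aff_dim F) = i}. monom (1::int) i)"
      by (rule sum.cong) auto
    ultimately show "monom (int (card {F. F face_of P \<and> aff_dim F = int i})) i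
        = (\<Sum>F\<in>{F. F \<in> ?S \<and> nat (aff_dim F) = i}. monom 1 (nat (aff_dim F)))"
      by (simp add: of_nat_poly smult_monom)
  qed
  also have "\<dots> = (\<Sum>F\<in>?S. monom 1 (nat (aff_dim F)))"
  proof (rule sum.group[OF fin])
    show "(\<lambda>F. nat (aff_dim F)) ` ?S \<subseteq> {0..nat (aff_dim P)}"
      by (auto intro!: nat_mono aff_dim_subset dest: face_of_imp_subset)
  qed simp
  finally show ?thesis .
qed

text \<open>A nonempty relatively open part of an affine set already has its full dimension, so
  anything squeezed in between has it too. This serves cells, closed faces and hyperplane sections
  of cells alike.\<close>

lemma aff_dim_between:
  fixes X :: "'a::euclidean_space set"
  assumes "affine N" "open U" "N \<inter> U \<noteq> {}" "N \<inter> U \<subseteq> X" "X \<subseteq> N"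
  shows "aff_dim X = aff_dim N"
  using aff_dim_subset[OF assms(4)] aff_dim_subset[OF assms(5)]
    aff_dim_convex_Int_open[OF affine_imp_convex[OF assms(1)] assms(2,3)] by linarith

text \<open>Equations are kept in the affine set \<open>M\<close> and only inequalities are indexed
  by \<open>'q\<close>, so a tight set never has to record an equation. Since \<open>'q\<close> is
  finite, sums over all \<open>I :: 'q set\<close> are finite, and adding an inequality merely
  enlarges the index type.\<close>

locale polyhedron_data =
  fixes M :: "'a::euclidean_space set" and a :: "'q::finite \<Rightarrow> 'a" and b :: "'q \<Rightarrow> real"
  assumes affine_M: "affine M"
begin

definition pset :: "'a set" where
  "pset = {x \<in> M. \<forall>q. a q \<bullet> x \<le> b q}"

definition active :: "'a \<Rightarrow> 'q set" where
  "active x = {q. a q \<bullet> x = b q}"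

definition cell :: "'q set \<Rightarrow> 'a set" where
  "cell I = {x \<in> pset. active x = I}"

definition flat :: "'q set \<Rightarrow> 'a set" where
  "flat I = {x \<in> M. \<forall>q\<in>I. a q \<bullet> x = b q}"

text \<open>The open counterpart of \<open>flat\<close>: a cell is \<open>flat I\<close> cut by the
  open set \<open>slack I\<close>, hence relatively open with the dimension of \<open>flat I\<close>
  as soon as it is nonempty.\<close>

definition slack :: "'q set \<Rightarrow> 'a set" where
  "slack I = {x. \<forall>q\<in>-I. a q \<bullet> x < b q}"

lemma convex_pset: "convex pset"
proof -
  have "pset = M \<inter> (\<Inter>q. {x. a q \<bullet> x \<le> b q})" by (auto simp: pset_def)
  then show ?thesis
    by (simp add: convex_Int affine_imp_convex[OF affine_M] convex_INT convex_halfspace_le)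
qed

lemma affine_flat: "affine (flat I)"
proof -
  have "flat I = M \<inter> (\<Inter>q\<in>I. {x. a q \<bullet> x = b q})" by (auto simp: flat_def)
  then show ?thesis
    by (auto intro!: affine_Int affine_M affine_Inter affine_hyperplane)
qed

lemma open_slack: "open (slack I)"
proof -
  have "slack I = (\<Inter>q\<in>-I. {x. a q \<bullet> x < b q})" by (auto simp: slack_def)
  then show ?thesis
    by (auto intro!: open_INT open_halfspace_lt)
qed

lemma cell_eq: "cell I = flat I \<inter> slack I"
  unfolding cell_def flat_def slack_def pset_def active_def
  by (auto simp: less_le)

lemma cell_subset: "cell I \<subseteq> pset \<inter> flat I"
  by (auto simp: cell_def pset_def flat_def active_def)

lemma pset_flat_face: "(pset \<inter> flat I) face_of pset"
proof -
  \<comment> \<open>Each tight inequality gives a supporting hyperplane. \<open>pset\<close> itself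
    is inserted so that the family is nonempty even for \<open>I = {}\<close>.\<close>
  have "pset \<inter> flat I = \<Inter>(insert pset ((\<lambda>q. pset \<inter> {x. a q \<bullet> x = b q}) ` I))"
    by (auto simp: flat_def pset_def)
  moreover have "\<dots> face_of pset"
  proof (rule face_of_Inter)
    fix T assume "T \<in> insert pset ((\<lambda>q. pset \<inter> {x. a q \<bullet> x = b q}) ` I)"
    moreover have "(pset \<inter> {x. a q \<bullet> x = b q}) face_of pset" for q
      by (rule face_of_Int_supporting_hyperplane_le[OF convex_pset]) (auto simp: pset_def)
    ultimately show "T face_of pset"
      by (auto simp: face_of_refl convex_pset)
  qed simp
  ultimately show ?thesis by simp
qed

text \<open>The line through \<open>x\<close> and \<open>y\<close> stays in the affine set
  \<open>flat I\<close>, and near \<open>x\<close> it stays in the open set \<open>slack I\<close>;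
  so the segment from \<open>y\<close> to \<open>x\<close> can be prolonged a little beyond
  \<open>x\<close> inside the cell.\<close>

lemma cell_extend:
  assumes x: "x \<in> cell I" and y: "y \<in> flat I"
  shows "\<exists>e>0. x + e *\<^sub>R (x - y) \<in> cell I"
proof -
  have "((\<lambda>e. x + e *\<^sub>R (x - y)) \<longlongrightarrow> x + 0 *\<^sub>R (x - y)) (at_right 0)"
    by (intro tendsto_intros)
  then have "\<forall>\<^sub>F e in at_right 0. x + e *\<^sub>R (x - y) \<in> slack I"
    by (rule topological_tendstoD[OF _ open_slack]) (use x cell_eq in auto)
  then have "\<forall>\<^sub>F e in at_right 0. e > 0 \<and> x + e *\<^sub>R (x - y) \<in> slack I"
    using eventually_at_right_less[of "0::real"] by eventually_elim auto
  then obtain e where e: "e > 0" "x + e *\<^sub>R (x - y) \<in> slack I"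
    using eventually_happens'[OF trivial_limit_at_right_real] by blast
  have "x + e *\<^sub>R (x - y) = (1 + e) *\<^sub>R x + (- e) *\<^sub>R y"
    by (simp add: algebra_simps)
  also have "\<dots> \<in> flat I"
    using x y by (intro mem_affine[OF affine_flat]) (auto simp: cell_eq)
  finally show ?thesis using e by (auto simp: cell_eq)
qed

text \<open>One inclusion holds because \<open>F\<close> has a relative interior point in the face
  \<open>pset \<inter> flat (active x)\<close>. For the other, a segment from \<open>y\<close> is
  prolonged beyond \<open>x\<close>; then \<open>x\<close> lies strictly between two points of
  \<open>pset\<close>, and the face \<open>F\<close> must contain both.\<close>

lemma face_eq_flat:
  assumes F: "F face_of pset" and x: "x \<in> rel_interior F"
  shows "F = pset \<inter> flat (active x)"
proof
  have xF: "x \<in> F" using x rel_interior_subset by auto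
  then have xP: "x \<in> pset" using F face_of_imp_subset by auto
  show "F \<subseteq> pset \<inter> flat (active x)"
  proof (rule subset_of_face_of[OF pset_flat_face])
    show "F \<subseteq> pset" using F face_of_imp_subset by auto
    show "pset \<inter> flat (active x) \<inter> rel_interior F \<noteq> {}"
      using x xP by (auto simp: disjoint_iff pset_def flat_def active_def)
  qed
  show "pset \<inter> flat (active x) \<subseteq> F"
  proof
    fix y assume y: "y \<in> pset \<inter> flat (active x)"
    show "y \<in> F"
    proof (cases "y = x")
      case False
      have "x \<in> cell (active x)" using xP by (simp add: cell_def)
      then obtain e where e: "e > 0" and "x + e *\<^sub>R (x - y) \<in> cell (active x)"
        using cell_extend y by blast
      then have z: "x + e *\<^sub>R (x - y) \<in> pset" by (simp add: cell_def)
      let ?z = "x + e *\<^sub>R (x - y)"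
      \<comment> \<open>Since \<open>?z - y = (1 + e) *\<^sub>R (x - y)\<close>, the weight of
        \<open>?z\<close> is \<open>1 / (1 + e)\<close>.\<close>
      have "x = (1 - 1 / (1 + e)) *\<^sub>R y + (1 / (1 + e)) *\<^sub>R ?z"
      proof -
        have "?z = y + (1 + e) *\<^sub>R (x - y)" by (simp add: algebra_simps)
        then have "(1 - 1 / (1 + e)) *\<^sub>R y + (1 / (1 + e)) *\<^sub>R ?z
            = y + ((1 / (1 + e)) * (1 + e)) *\<^sub>R (x - y)"
          by (simp only: scaleR_add_right scaleR_diff_left scaleR_scaleR scaleR_one) simp
        then show ?thesis using e by simp
      qed
      moreover have "?z \<noteq> y"
      proof
        assume "?z = y"
        then have "(1 + e) *\<^sub>R (x - y) = 0" by (simp add: algebra_simps)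
        then show False using False e by simp
      qed
      moreover have "0 < 1 / (1 + e)" "1 / (1 + e) < 1" using e by auto
      ultimately have "x \<in> open_segment y ?z"
        unfolding in_segment by metis
      then show ?thesis
        using F y z xF unfolding face_of_def by blast
    qed (use xF in simp)
  qed
qed

text \<open>A nonempty face is recovered from the tight set of any of its relative interior points.
  The index set is restricted to tight sets that really occur, because different \<open>I\<close>
  may cut out the same face.\<close>

lemma bij_faces: "bij_betw (\<lambda>I. pset \<inter> flat I) (active ` pset) {F. F face_of pset \<and> F \<noteq> {}}"
  unfolding bij_betw_def
proof
  show "inj_on (\<lambda>I. pset \<inter> flat I) (active ` pset)"
  proof (rule inj_onI, clarify)
    fix x y assume "x \<in> pset" "y \<in> pset" and eq: "pset \<inter> flat (active x) = pset \<inter> flat (active y)"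
    have "x \<in> pset \<inter> flat (active x)" "y \<in> pset \<inter> flat (active y)"
      using \<open>x \<in> pset\<close> \<open>y \<in> pset\<close> by (auto simp: pset_def flat_def active_def)
    then have "x \<in> flat (active y)" "y \<in> flat (active x)" using eq by auto
    then show "active x = active y" by (auto simp: flat_def active_def)
  qed
  show "(\<lambda>I. pset \<inter> flat I) ` active ` pset = {F. F face_of pset \<and> F \<noteq> {}}"
  proof
    show "(\<lambda>I. pset \<inter> flat I) ` active ` pset \<subseteq> {F. F face_of pset \<and> F \<noteq> {}}"
      using pset_flat_face by (auto simp: pset_def flat_def active_def)
    show "{F. F face_of pset \<and> F \<noteq> {}} \<subseteq> (\<lambda>I. pset \<inter> flat I) ` active ` pset"
    proof clarify
      fix F assume F: "F face_of pset" "F \<noteq> {}"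
      then obtain x where "x \<in> rel_interior F"
        using face_of_imp_convex rel_interior_eq_empty by blast
      then have "F = pset \<inter> flat (active x)" "x \<in> pset"
        using face_eq_flat F rel_interior_subset face_of_imp_subset by blast+
      then show "F \<in> (\<lambda>I. pset \<inter> flat I) ` active ` pset" by blast
    qed
  qed
qed

lemma cell_nonempty: "I \<in> active ` pset \<longleftrightarrow> cell I \<noteq> {}"
  by (auto simp: cell_def)

lemma aff_dim_cell:
  assumes "cell I \<noteq> {}"
  shows "aff_dim (cell I) = aff_dim (flat I)"
  by (rule aff_dim_between[OF affine_flat open_slack]) (use assms in \<open>auto simp: cell_eq\<close>)

text \<open>The closed face \<open>pset \<inter> flat I\<close> and its cell both lie between
  \<open>flat I \<inter> slack I\<close> and \<open>flat I\<close>, so faces may be replaced by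
  cells without changing dimensions.\<close>

lemma f_poly_pset:
  "f_poly pset = (\<Sum>I | cell I \<noteq> {}. monom 1 (nat (aff_dim (cell I))))"
proof -
  have "{F. F face_of pset} \<subseteq> insert {} ((\<lambda>I. pset \<inter> flat I) ` active ` pset)"
    using bij_faces by (auto simp: bij_betw_def)
  then have "finite {F. F face_of pset}" by (rule finite_subset) simp
  then have "f_poly pset = (\<Sum>F\<in>{F. F face_of pset \<and> F \<noteq> {}}. monom 1 (nat (aff_dim F)))"
    by (rule f_poly_eq_sum_faces)
  also have "\<dots> = (\<Sum>I\<in>active ` pset. monom 1 (nat (aff_dim (pset \<inter> flat I))))"
    by (rule sum.reindex_bij_betw[OF bij_faces, symmetric])
  also have "\<dots> = (\<Sum>I | cell I \<noteq> {}. monom 1 (nat (aff_dim (cell I))))"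
  proof (rule sum.cong)
    fix I assume "I \<in> {I. cell I \<noteq> {}}"
    then have "cell I \<noteq> {}" by simp
    have "aff_dim (pset \<inter> flat I) = aff_dim (flat I)"
      by (rule aff_dim_between[OF affine_flat open_slack[of I]])
        (use \<open>cell I \<noteq> {}\<close> cell_subset in \<open>simp_all add: cell_eq[symmetric]\<close>)
    then show "monom (1::int) (nat (aff_dim (pset \<inter> flat I))) = monom 1 (nat (aff_dim (cell I)))"
      using aff_dim_cell[OF \<open>cell I \<noteq> {}\<close>] by simp
  qed (use cell_nonempty in auto)
  finally show ?thesis .
qed

section \<open>Cutting by a half-space\<close>

lemma convex_cell: "convex (cell I)"
proof -
  have "slack I = (\<Inter>q\<in>-I. {x. a q \<bullet> x < b q})" by (auto simp: slack_def)
  then have "convex (slack I)" by (simp add: convex_INT convex_halfspace_lt)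
  then show ?thesis
    by (simp add: cell_eq convex_Int affine_imp_convex affine_flat)
qed

text \<open>The cut polyhedron is a second instance of the same locale, with the new inequality
  indexed by \<open>None\<close>. Its cells are those of \<open>pset\<close> intersected with the
  open half-space or with the hyperplane, according to whether \<open>None\<close> is tight.\<close>

lemma f_poly_halfspace_cells:
  "f_poly (pset \<inter> {x. c \<bullet> x \<le> d}) =
     (\<Sum>I | cell I \<inter> {x. c \<bullet> x < d} \<noteq> {}. monom 1 (nat (aff_dim (cell I \<inter> {x. c \<bullet> x < d}))))
   + (\<Sum>I | cell I \<inter> {x. c \<bullet> x = d} \<noteq> {}. monom 1 (nat (aff_dim (cell I \<inter> {x. c \<bullet> x = d}))))"
proof -
  interpret S: polyhedron_data M "case_option c a" "case_option d b"
    by unfold_locales (rule affine_M)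
  define J where "J = (\<lambda>I. Some ` I :: 'q option set)"
  have pset: "S.pset = pset \<inter> {x. c \<bullet> x \<le> d}"
    by (auto simp: S.pset_def pset_def split_option_all)
  have act: "S.active x = J (active x) \<union> (if c \<bullet> x = d then {None} else {})" for x
  proof (rule set_eqI)
    show "q \<in> S.active x \<longleftrightarrow> q \<in> J (active x) \<union> (if c \<bullet> x = d then {None} else {})" for q
      by (cases q) (auto simp: S.active_def active_def J_def)
  qed
  have JJ: "J I = J I' \<longleftrightarrow> I = I'" "None \<notin> J I" for I I'
    by (auto simp: J_def inj_image_eq_iff)
  have J1: "S.cell (J I) = cell I \<inter> {x. c \<bullet> x < d}" for I
    using JJ by (auto simp: S.cell_def cell_def pset act split: if_splits)
  have J2: "S.cell (insert None (J I)) = cell I \<inter> {x. c \<bullet> x = d}" for I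
    using JJ by (auto simp: S.cell_def cell_def pset act insert_ident split: if_splits)
  \<comment> \<open>Every set of indices of the cut polyhedron arises from an old one with or
    without \<open>None\<close>, so the reindexing below misses no cell.\<close>
  have all: "\<exists>I. K = J I \<or> K = insert None (J I)" for K
  proof (rule exI[of _ "Some -` K"])
    have "y \<in> K \<longleftrightarrow> y \<in> J (Some -` K) \<or> (y = None \<and> None \<in> K)" for y
      by (cases y) (auto simp: J_def)
    then show "K = J (Some -` K) \<or> K = insert None (J (Some -` K))" by blast
  qed
  let ?A = "{I. cell I \<inter> {x. c \<bullet> x < d} \<noteq> {}}" and ?B = "{I. cell I \<inter> {x. c \<bullet> x = d} \<noteq> {}}"
  let ?g = "\<lambda>K. monom (1::int) (nat (aff_dim (S.cell K)))"
  have eq: "{K. S.cell K \<noteq> {}} = J ` ?A \<union> (\<lambda>I. insert None (J I)) ` ?B"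
  proof
    show "{K. S.cell K \<noteq> {}} \<subseteq> J ` ?A \<union> (\<lambda>I. insert None (J I)) ` ?B"
    proof
      fix K assume K: "K \<in> {K. S.cell K \<noteq> {}}"
      obtain I where "K = J I \<or> K = insert None (J I)" using all by blast
      then show "K \<in> J ` ?A \<union> (\<lambda>I. insert None (J I)) ` ?B"
        using K J1[of I] J2[of I] by auto
    qed
  qed (use J1 J2 in auto)
  have "f_poly S.pset = sum ?g (J ` ?A) + sum ?g ((\<lambda>I. insert None (J I)) ` ?B)"
    unfolding S.f_poly_pset eq
    by (rule sum.union_disjoint) (use JJ in auto)
  also have "sum ?g (J ` ?A) = (\<Sum>I\<in>?A. ?g (J I))"
    by (rule sum.reindex_cong[OF _ refl refl]) (auto simp: inj_on_def JJ)
  also have "sum ?g ((\<lambda>I. insert None (J I)) ` ?B) = (\<Sum>I\<in>?B. ?g (insert None (J I)))"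
    by (rule sum.reindex_cong[OF _ refl refl]) (auto simp: inj_on_def insert_ident JJ)
  finally show ?thesis unfolding pset J1 J2 .
qed

text \<open>A cell that touches the hyperplane at \<open>x\<close> without lying in it must cross
  it: prolonging the segment from \<open>y\<close> slightly beyond \<open>x\<close> reaches the
  opposite side.\<close>

lemma cell_cross:
  assumes "x \<in> cell I" "y \<in> cell I" "c \<bullet> x = d"
  shows "c \<bullet> y < d \<Longrightarrow> \<exists>z\<in>cell I. c \<bullet> z > d" "c \<bullet> y > d \<Longrightarrow> \<exists>z\<in>cell I. c \<bullet> z < d"
proof -
  obtain e where e: "e > 0" "x + e *\<^sub>R (x - y) \<in> cell I"
    using cell_extend[OF assms(1)] assms(2) cell_eq by blast
  have v: "c \<bullet> (x + e *\<^sub>R (x - y)) = d + e * (d - c \<bullet> y)"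
    using assms(3) by (simp add: inner_add_right inner_diff_right)
  show "\<exists>z\<in>cell I. c \<bullet> z > d" if "c \<bullet> y < d"
    using e that by (intro bexI[OF _ e(2)]) (simp add: v)
  show "\<exists>z\<in>cell I. c \<bullet> z < d" if "c \<bullet> y > d"
    using e that by (intro bexI[OF _ e(2)]) (simp add: v mult_pos_neg)
qed

lemma cell_between:
  assumes "x \<in> cell I" "y \<in> cell I" "c \<bullet> x < d" "c \<bullet> y > d"
  shows "\<exists>z\<in>cell I. c \<bullet> z = d"
proof -
  have "connected (cell I)" by (rule convex_connected[OF convex_cell])
  then show ?thesis
    using connected_ivt_hyperplane[of "cell I" x y c d] assms by auto
qed

text \<open>The points \<open>x\<close> on and \<open>y\<close> off the hyperplane show that it
  meets \<open>flat I\<close> without containing it, which lowers the dimension by exactly one; the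
  section of the cell is relatively open in the section of \<open>flat I\<close>.\<close>

lemma aff_dim_cell_hyperplane:
  assumes "x \<in> cell I" "c \<bullet> x = d" "y \<in> cell I" "c \<bullet> y \<noteq> d"
  shows "aff_dim (cell I \<inter> {x. c \<bullet> x = d}) = aff_dim (cell I) - 1"
proof -
  have x: "x \<in> flat I" "x \<in> slack I" and y: "y \<in> flat I" using assms cell_eq by auto
  have "aff_dim (cell I \<inter> {x. c \<bullet> x = d}) = aff_dim (flat I \<inter> {x. c \<bullet> x = d})"
    by (rule aff_dim_between[OF _ open_slack[of I]])
      (use x assms in \<open>auto simp: cell_eq intro!: affine_Int affine_flat affine_hyperplane\<close>)
  also have "\<dots> = aff_dim (flat I) - 1"
    using x y assms by (subst aff_dim_affine_Int_hyperplane[OF affine_flat]) auto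
  also have "\<dots> = aff_dim (cell I) - 1"
    using assms by (subst aff_dim_cell) auto
  finally show ?thesis .
qed

lemma f_poly_diff_halfspace:
  "f_poly pset - f_poly (pset \<inter> {x. c \<bullet> x \<le> d}) =
     (\<Sum>I | \<exists>x\<in>cell I. c \<bullet> x > d. monom 1 (nat (aff_dim (cell I))))
   - (\<Sum>I | (\<exists>x\<in>cell I. c \<bullet> x > d) \<and> (\<exists>x\<in>cell I. c \<bullet> x < d).
        monom 1 (nat (aff_dim (cell I))) + monom 1 (nat (aff_dim (cell I)) - 1))"
proof -
  define G where "G I \<longleftrightarrow> (\<exists>x\<in>cell I. c \<bullet> x > d)" for I
  define L where "L I \<longleftrightarrow> (\<exists>x\<in>cell I. c \<bullet> x < d)" for I
  define E where "E I \<longleftrightarrow> (\<exists>x\<in>cell I. c \<bullet> x = d)" for I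
  define t where "t X = monom (1::int) (nat (aff_dim X))" for X :: "'a set"
  let ?L = "{x. c \<bullet> x < d}" and ?E = "{x. c \<bullet> x = d}"
  have eqs: "(cell I \<inter> ?L \<noteq> {}) = L I" "(cell I \<inter> ?E \<noteq> {}) = E I" "(cell I \<noteq> {}) = (G I \<or> L I \<or> E I)" for I
    by (auto simp: L_def E_def G_def) force
  \<comment> \<open>The identity is checked separately for each tight set, where only the four
    combinations of \<open>G I\<close> and \<open>L I\<close> matter; \<open>E I\<close> is forced
    or harmless in each of them.\<close>
  have *: "(if G I \<or> L I \<or> E I then t (cell I) else 0) -
      ((if L I then t (cell I \<inter> ?L) else 0) + (if E I then t (cell I \<inter> ?E) else 0))
     = (if G I then t (cell I) else 0)
       - (if G I \<and> L I then t (cell I) + monom 1 (nat (aff_dim (cell I)) - 1) else 0)" for I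
  proof -
    have tL: "t (cell I \<inter> ?L) = t (cell I)" if "L I"
      using aff_dim_convex_Int_open[OF convex_cell open_halfspace_lt, of I c d] that eqs(1)
      by (simp add: t_def)
    show ?thesis
    proof (cases "G I"; cases "L I")
      assume GL: "G I" "L I"
      then have "E I" using cell_between by (auto simp: G_def L_def E_def)
      then have "aff_dim (cell I \<inter> ?E) = aff_dim (cell I) - 1"
        using aff_dim_cell_hyperplane[of _ I c d] GL by (auto simp: G_def E_def)
      then have "nat (aff_dim (cell I \<inter> ?E)) = nat (aff_dim (cell I)) - 1"
        by linarith
      then have "t (cell I \<inter> ?E) = monom 1 (nat (aff_dim (cell I)) - 1)"
        by (simp add: t_def)
      then show ?thesis using GL tL \<open>E I\<close> by simp
    next
      assume GL: "G I" "\<not> L I"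
      then have "\<not> E I" using cell_cross(2) unfolding G_def L_def E_def by blast
      then show ?thesis using GL by simp
    next
      assume GL: "\<not> G I" "L I"
      then have "\<not> E I" using cell_cross(1) unfolding G_def L_def E_def by blast
      then show ?thesis using GL tL by simp
    next
      assume GL: "\<not> G I" "\<not> L I"
      \<comment> \<open>The cell lies inside the hyperplane and survives unchanged, so its
        contribution cancels.\<close>
      then have "cell I \<inter> ?E = cell I" by (force simp: G_def L_def)
      then show ?thesis using GL by simp
    qed
  qed
  have "f_poly pset - f_poly (pset \<inter> {x. c \<bullet> x \<le> d}) =
     (\<Sum>I | G I \<or> L I \<or> E I. t (cell I))
     - ((\<Sum>I | L I. t (cell I \<inter> ?L)) + (\<Sum>I | E I. t (cell I \<inter> ?E)))"
    unfolding f_poly_pset f_poly_halfspace_cells eqs t_def ..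
  also have "\<dots> = (\<Sum>I\<in>UNIV. (if G I \<or> L I \<or> E I then t (cell I) else 0) -
      ((if L I then t (cell I \<inter> ?L) else 0) + (if E I then t (cell I \<inter> ?E) else 0)))"
    by (simp add: sum.inter_filter[symmetric] sum_subtractf sum.distrib)
  also have "\<dots> = (\<Sum>I | G I. t (cell I))
      - (\<Sum>I | G I \<and> L I. t (cell I) + monom 1 (nat (aff_dim (cell I)) - 1))"
    unfolding * by (simp add: sum.inter_filter[symmetric] sum_subtractf)
  finally show ?thesis unfolding G_def L_def t_def .
qed

end

section \<open>Cells of the hypersimplex\<close>

definition hcell :: "nat \<Rightarrow> 'n::finite set \<Rightarrow> 'n set \<Rightarrow> (real ^ 'n) set" where
  "hcell k A B = {x \<in> hypersimplex k. {i. x $ i = 1} = A \<and> {i. x $ i = 0} = B}"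

text \<open>The possible values of the sum over \<open>S\<close> when the coordinates in \<open>A\<close> are \<open>1\<close>, those in \<open>B\<close>
  are \<open>0\<close> and the others lie strictly in between.\<close>

definition attainable :: "'n set \<Rightarrow> 'n set \<Rightarrow> 'n set \<Rightarrow> real \<Rightarrow> bool" where
  "attainable A B S s \<longleftrightarrow> S \<subseteq> A \<union> B \<and> s = real (card (A \<inter> S))
     \<or> real (card (A \<inter> S)) < s \<and> s + real (card (B \<inter> S)) < real (card S)"

lemma card_free:
  fixes S :: "'n::finite set"
  assumes "A \<inter> B = {}"
  shows "card S = card (A \<inter> S) + card (B \<inter> S) + card (S - (A \<union> B))"
proof -
  have "S = (A \<inter> S) \<union> (B \<inter> S) \<union> (S - (A \<union> B))" by auto
  then have "card S = card ((A \<inter> S) \<union> (B \<inter> S) \<union> (S - (A \<union> B)))" by simp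
  also have "\<dots> = card ((A \<inter> S) \<union> (B \<inter> S)) + card (S - (A \<union> B))"
    by (rule card_Un_disjoint) auto
  also have "card ((A \<inter> S) \<union> (B \<inter> S)) = card (A \<inter> S) + card (B \<inter> S)"
    by (rule card_Un_disjoint) (use assms in auto)
  finally show ?thesis .
qed

lemma sum_free:
  fixes f :: "'n::finite \<Rightarrow> real"
  assumes "A \<inter> B = {}" "\<And>i. i \<in> A \<inter> S \<Longrightarrow> f i = 1" "\<And>i. i \<in> B \<inter> S \<Longrightarrow> f i = 0"
  shows "sum f S = card (A \<inter> S) + sum f (S - (A \<union> B))"
proof -
  have "S = (A \<inter> S) \<union> (B \<inter> S) \<union> (S - (A \<union> B))" by auto
  then have "sum f S = sum f ((A \<inter> S) \<union> (B \<inter> S) \<union> (S - (A \<union> B)))" by simp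
  also have "\<dots> = sum f ((A \<inter> S) \<union> (B \<inter> S)) + sum f (S - (A \<union> B))"
    by (rule sum.union_disjoint) auto
  also have "sum f ((A \<inter> S) \<union> (B \<inter> S)) = sum f (A \<inter> S) + sum f (B \<inter> S)"
    by (rule sum.union_disjoint) (use assms in auto)
  finally show ?thesis using assms(2,3) by simp
qed

text \<open>Free coordinates lie strictly between 0 and 1, so their sum lies strictly between 0 and
  their number, unless there are none.\<close>

lemma attainable_sum:
  fixes f :: "'n::finite \<Rightarrow> real"
  assumes "A \<inter> B = {}" "\<And>i. i \<in> S \<Longrightarrow> f i = 1 \<longleftrightarrow> i \<in> A" "\<And>i. i \<in> S \<Longrightarrow> f i = 0 \<longleftrightarrow> i \<in> B"
    "\<And>i. i \<in> S \<Longrightarrow> 0 \<le> f i \<and> f i \<le> 1"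
  shows "attainable A B S (sum f S)"
proof -
  let ?R = "S - (A \<union> B)"
  have s: "sum f S = card (A \<inter> S) + sum f ?R"
    by (rule sum_free) (use assms in auto)
  show ?thesis
  proof (cases "?R = {}")
    case True
    then have R: "sum f ?R = 0" by (simp only: sum.empty)
    show ?thesis using True unfolding attainable_def s R by auto
  next
    case False
    have bd: "0 < f i" "f i < 1" if "i \<in> ?R" for i
      using assms(2-4)[of i] that by (auto simp: less_le)
    have "0 < sum f ?R" by (rule sum_pos) (use False bd in auto)
    moreover have "sum f ?R < (\<Sum>i\<in>?R. 1)" by (rule sum_strict_mono) (use False bd in auto)
    ultimately show ?thesis
      unfolding attainable_def s card_free[OF assms(1), of S] by simp
  qed
qed

lemma attainable_witness:
  fixes A B S :: "'n::finite set"
  assumes AB: "A \<inter> B = {}" and s: "attainable A B S s"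
  obtains f where "\<And>i. i \<in> S \<Longrightarrow> f i = (1::real) \<longleftrightarrow> i \<in> A" "\<And>i. i \<in> S \<Longrightarrow> f i = 0 \<longleftrightarrow> i \<in> B"
    "\<And>i. i \<in> S \<Longrightarrow> 0 \<le> f i \<and> f i \<le> 1" "sum f S = s"
proof -
  let ?R = "S - (A \<union> B)"
  \<comment> \<open>The part of \<open>s\<close> not supplied by the ones is spread evenly over the
    free coordinates of \<open>S\<close>; the strict bounds in \<open>attainable\<close> say
    precisely that this average lies strictly between 0 and 1.\<close>
  define u where "u = (s - card (A \<inter> S)) / card ?R"
  define f where "f i = (if i \<in> A then 1 else if i \<in> B then 0 else u)" for i
  have u: "0 < u \<and> u < 1" if "i \<in> ?R" for i
  proof -
    have "card ?R > 0" using that by (auto simp: card_gt_0_iff)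
    moreover have "card (A \<inter> S) < s" "s + card (B \<inter> S) < card S"
      using s that unfolding attainable_def by auto
    ultimately show ?thesis using card_free[OF AB, of S] by (simp add: u_def)
  qed
  have "sum f S = card (A \<inter> S) + sum f ?R"
    by (rule sum_free[OF AB]) (use AB in \<open>auto simp: f_def\<close>)
  also have "sum f ?R = card ?R * u" by (simp add: f_def)
  also have "card (A \<inter> S) + card ?R * u = s"
  proof (cases "?R = {}")
    case True
    then have "card S = card (A \<inter> S) + card (B \<inter> S)" using card_free[OF AB, of S] by simp
    then show ?thesis using s True unfolding attainable_def by auto
  next
    case False
    then show ?thesis by (simp add: u_def card_gt_0_iff)
  qed
  finally have "sum f S = s" .
  moreover have "f i = 1 \<longleftrightarrow> i \<in> A" "f i = 0 \<longleftrightarrow> i \<in> B" "0 \<le> f i \<and> f i \<le> 1" if "i \<in> S" for i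
    using u[of i] AB that by (auto simp: f_def)
  ultimately show ?thesis by (intro that) auto
qed

text \<open>Coordinates in \<open>S\<close> and outside \<open>S\<close> can be chosen independently
  once the total \<open>k\<close> has been divided into \<open>s\<close> and
  \<open>k - s\<close>.\<close>

lemma hcell_sum_iff:
  "(\<exists>x\<in>hcell k A B. (\<Sum>i\<in>S. x $ i) = s) \<longleftrightarrow>
     A \<inter> B = {} \<and> attainable A B S s \<and> attainable A B (-S) (k - s)"
proof safe
  fix x assume x: "x \<in> hcell k A B"
  then have AB: "A \<inter> B = {}" by (auto simp: hcell_def)
  show "i \<in> {}" if "i \<in> A" "i \<in> B" for i using that AB by auto
  have x': "x $ i = 1 \<longleftrightarrow> i \<in> A" "x $ i = 0 \<longleftrightarrow> i \<in> B" "0 \<le> x $ i \<and> x $ i \<le> 1" for i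
    using x by (auto simp: hcell_def hypersimplex_def)
  show "attainable A B S (\<Sum>i\<in>S. x $ i)"
    by (rule attainable_sum[OF AB]) (use x' in auto)
  have "(\<Sum>i\<in>UNIV. x $ i) = (\<Sum>i\<in>S. x $ i) + (\<Sum>i\<in>-S. x $ i)"
    by (subst sum.union_disjoint[symmetric]) auto
  then have "k - (\<Sum>i\<in>S. x $ i) = (\<Sum>i\<in>-S. x $ i)"
    using x by (auto simp: hcell_def hypersimplex_def)
  then show "attainable A B (-S) (k - (\<Sum>i\<in>S. x $ i))"
    by simp (rule attainable_sum[OF AB], use x' in auto)
next
  assume AB: "A \<inter> B = {}" and 1: "attainable A B S s" and 2: "attainable A B (-S) (k - s)"
  obtain f where f: "\<And>i. i \<in> S \<Longrightarrow> f i = (1::real) \<longleftrightarrow> i \<in> A" "\<And>i. i \<in> S \<Longrightarrow> f i = 0 \<longleftrightarrow> i \<in> B"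
    "\<And>i. i \<in> S \<Longrightarrow> 0 \<le> f i \<and> f i \<le> 1" "sum f S = s"
    using attainable_witness[OF AB 1] by metis
  obtain g where g: "\<And>i. i \<in> -S \<Longrightarrow> g i = (1::real) \<longleftrightarrow> i \<in> A" "\<And>i. i \<in> -S \<Longrightarrow> g i = 0 \<longleftrightarrow> i \<in> B"
    "\<And>i. i \<in> -S \<Longrightarrow> 0 \<le> g i \<and> g i \<le> 1" "sum g (-S) = k - s"
    using attainable_witness[OF AB 2] by metis
  define x where "x = (\<chi> i. if i \<in> S then f i else g i)"
  have x: "x $ i = (if i \<in> S then f i else g i)" for i by (simp add: x_def)
  have S: "(\<Sum>i\<in>S. x $ i) = s" using f(4) by (simp add: x)
  have "(\<Sum>i\<in>-S. x $ i) = k - s" using g(4) by (simp add: x)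
  moreover have "(\<Sum>i\<in>UNIV. x $ i) = (\<Sum>i\<in>S. x $ i) + (\<Sum>i\<in>-S. x $ i)"
    by (subst sum.union_disjoint[symmetric]) auto
  ultimately have "(\<Sum>i\<in>UNIV. x $ i) = k" using S by simp
  moreover have "x $ i = 1 \<longleftrightarrow> i \<in> A" "x $ i = 0 \<longleftrightarrow> i \<in> B" "0 \<le> x $ i \<and> x $ i \<le> 1" for i
    using f(1-3)[of i] g(1-3)[of i] by (auto simp: x)
  ultimately have "x \<in> hcell k A B" unfolding hcell_def hypersimplex_def by auto
  then show "\<exists>x\<in>hcell k A B. (\<Sum>i\<in>S. x $ i) = s" using S by blast
qed

lemma hcell_nonempty_iff:
  fixes A B :: "'n::finite set"
  shows "hcell k A B \<noteq> {} \<longleftrightarrow> A \<inter> B = {} \<and>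
     (A \<union> B = UNIV \<and> card A = k \<or> card A < k \<and> k + card B < CARD('n))"
proof -
  \<comment> \<open>The case \<open>S = UNIV\<close> of the preceding criterion, as every point of
    the hypersimplex has coordinate sum \<open>k\<close>.\<close>
  have "hcell k A B \<noteq> {} \<longleftrightarrow> (\<exists>x\<in>hcell k A B. (\<Sum>i\<in>UNIV. x $ i) = real k)"
    by (auto simp: hcell_def hypersimplex_def)
  also have "\<dots> \<longleftrightarrow> A \<inter> B = {} \<and> attainable A B UNIV (real k) \<and> attainable A B {} (0::real)"
    by (subst hcell_sum_iff) simp
  also have "\<dots> \<longleftrightarrow> A \<inter> B = {} \<and>
     (A \<union> B = UNIV \<and> card A = k \<or> card A < k \<and> k + card B < CARD('n))"
    unfolding attainable_def by (auto simp flip: of_nat_add)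
  finally show ?thesis .
qed

lemma hcell_vertex:
  fixes A :: "'n::finite set"
  assumes "card A = k"
  shows "hcell k A (-A) = {\<chi> i. if i \<in> A then 1 else 0}"
proof
  show "hcell k A (-A) \<subseteq> {\<chi> i. if i \<in> A then 1 else 0}"
    by (auto simp: hcell_def vec_eq_iff)
  show "{\<chi> i. if i \<in> A then 1 else 0} \<subseteq> hcell k A (-A)"
    using assms by (auto simp: hcell_def hypersimplex_def sum.If_cases)
qed

text \<open>The possible sums over \<open>S\<close> form a single point or an open interval. Its
  upper end is the smaller of \<open>card S - card (B \<inter> S)\<close>, where the free
  coordinates of \<open>S\<close> tend to 1, and \<open>k - card (A - S)\<close>, where those
  outside \<open>S\<close> tend to 0; \<open>r\<close> has to lie below both.\<close>

lemma hcell_exceeds_iff: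
  fixes A B S :: "'n::finite set"
  assumes AB: "A \<inter> B = {}" and k: "card A < k" "k + card B < CARD('n)"
  shows "(\<exists>x\<in>hcell k A B. (\<Sum>i\<in>S. x $ i) > real r) \<longleftrightarrow>
    r + card (B \<inter> S) < card S \<and> r + card (A - S) < k"
proof -
  define i j l m \<sigma> \<sigma>' where d: "i = card (A \<inter> S)" "j = card (B \<inter> S)" "l = card (A \<inter> -S)" "m = card (B \<inter> -S)"
    "\<sigma> = card S" "\<sigma>' = card (-S)"
  have AS: "A - S = A \<inter> -S" by auto
  have split: "card X = card (X \<inter> S) + card (X \<inter> -S)" for X :: "'n set"
    by (subst card_Un_disjoint[symmetric]) (auto intro: arg_cong[where f = card])
  have kk: "i + l < k" "k + j + m < \<sigma> + \<sigma>'"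
    using k split[of A] split[of B] split[of UNIV] by (auto simp: d)
  have free: "\<sigma> \<ge> i + j" "S \<subseteq> A \<union> B \<longleftrightarrow> \<sigma> = i + j" "\<sigma>' \<ge> l + m" "-S \<subseteq> A \<union> B \<longleftrightarrow> \<sigma>' = l + m"
    using card_free[OF AB, of S] card_free[OF AB, of "-S"] by (auto simp: d)
  have att: "attainable A B S s \<longleftrightarrow> \<sigma> = i + j \<and> s = real i \<or> real i < s \<and> s + real j < real \<sigma>"
    "attainable A B (-S) s \<longleftrightarrow> \<sigma>' = l + m \<and> s = real l \<or> real l < s \<and> s + real m < real \<sigma>'" for s
    unfolding attainable_def using free by (auto simp: d)
  have "(\<exists>x\<in>hcell k A B. (\<Sum>i\<in>S. x $ i) > real r) \<longleftrightarrow>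
      (\<exists>s>real r. \<exists>x\<in>hcell k A B. (\<Sum>i\<in>S. x $ i) = s)" by auto
  also have "\<dots> \<longleftrightarrow> (\<exists>s>real r. (\<sigma> = i + j \<and> s = real i \<or> real i < s \<and> s + real j < real \<sigma>) \<and>
      (\<sigma>' = l + m \<and> real k - s = real l \<or> real l < real k - s \<and> real k - s + real m < real \<sigma>'))"
    unfolding hcell_sum_iff att using AB by simp
  also have "\<dots> \<longleftrightarrow> r + j < \<sigma> \<and> r + l < k"
  proof
    assume "\<exists>s>real r. (\<sigma> = i + j \<and> s = real i \<or> real i < s \<and> s + real j < real \<sigma>) \<and>
      (\<sigma>' = l + m \<and> real k - s = real l \<or> real l < real k - s \<and> real k - s + real m < real \<sigma>')"
    then obtain s where s: "s > real r" "\<sigma> = i + j \<and> s = real i \<or> real i < s \<and> s + real j < real \<sigma>"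
      "\<sigma>' = l + m \<and> real k - s = real l \<or> real l < real k - s \<and> real k - s + real m < real \<sigma>'" by blast
    have "s + j \<le> \<sigma>" "s + l \<le> k" using s by auto
    then have "real (r + j) < real \<sigma>" "real (r + l) < real k" using s(1) by auto
    then show "r + j < \<sigma> \<and> r + l < k" by (simp only: of_nat_less_iff)
  next
    assume rr: "r + j < \<sigma> \<and> r + l < k"
    show "\<exists>s>real r. (\<sigma> = i + j \<and> s = real i \<or> real i < s \<and> s + real j < real \<sigma>) \<and>
      (\<sigma>' = l + m \<and> real k - s = real l \<or> real l < real k - s \<and> real k - s + real m < real \<sigma>')"
    proof -
      \<comment> \<open>If one of the two blocks has no free coordinate, the sum is forced to be
        \<open>i\<close> or \<open>k - l\<close>; otherwise an interval of values is
        available.\<close>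
      consider "\<sigma> = i + j" | "\<sigma> > i + j" "\<sigma>' = l + m" | "\<sigma> > i + j" "\<sigma>' > l + m"
        using free by linarith
      then show ?thesis
      proof cases
        case 1
        then show ?thesis using rr kk by (intro exI[of _ "real i"]) auto
      next
        case 2
        then show ?thesis using rr kk by (intro exI[of _ "real k - real l"]) auto
      next
        case 3
        \<comment> \<open>The strict lower bounds, including \<open>r\<close>, stay below the strict
          upper bounds, so any value in the gap will do.\<close>
        have "max (real i) (max (real k - (real \<sigma>' - real m)) (real r)) < min (real \<sigma> - real j) (real k - real l)"
          using 3 rr kk by auto
        then obtain s where "max (real i) (max (real k - (real \<sigma>' - real m)) (real r)) < s"
          "s < min (real \<sigma> - real j) (real k - real l)" using dense by blast
        then show ?thesis by (intro exI[of _ s]) auto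
      qed
    qed
  qed
  finally show ?thesis by (simp add: d AS)
qed

text \<open>As the total is \<open>k\<close>, falling below \<open>r\<close> on \<open>S\<close>
  means exceeding \<open>k - r\<close> on the complement, where the previous criterion
  applies.\<close>

lemma hcell_below_iff:
  fixes A B S :: "'n::finite set"
  assumes AB: "A \<inter> B = {}" and k: "card A < k" "k + card B < CARD('n)" and "r \<le> k"
  shows "(\<exists>x\<in>hcell k A B. (\<Sum>i\<in>S. x $ i) < real r) \<longleftrightarrow>
    k - r + card (B - S) < card (-S) \<and> card (A \<inter> S) < r"
proof -
  have "(\<Sum>i\<in>S. x $ i) < real r \<longleftrightarrow> (\<Sum>i\<in>-S. x $ i) > real (k - r)" if "x \<in> hcell k A B" for x
  proof -
    have "(\<Sum>i\<in>UNIV. x $ i) = (\<Sum>i\<in>S. x $ i) + (\<Sum>i\<in>-S. x $ i)"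
      by (subst sum.union_disjoint[symmetric]) auto
    then show ?thesis using that \<open>r \<le> k\<close> by (auto simp: hcell_def hypersimplex_def of_nat_diff)
  qed
  then have "(\<exists>x\<in>hcell k A B. (\<Sum>i\<in>S. x $ i) < real r) \<longleftrightarrow>
      (\<exists>x\<in>hcell k A B. (\<Sum>i\<in>-S. x $ i) > real (k - r))" by auto
  also have "\<dots> \<longleftrightarrow> k - r + card (B \<inter> -S) < card (-S) \<and> k - r + card (A - -S) < k"
    by (rule hcell_exceeds_iff[OF AB k])
  finally show ?thesis using \<open>r \<le> k\<close> by (auto simp: Diff_eq)
qed

section \<open>The hypersimplex as an instance of the locale, and the dimensions of its
  cells\<close>

interpretation hs: polyhedron_data "{x :: real ^ 'n. (\<Sum>i\<in>UNIV. x $ i) = real k}"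
  "case_sum (\<lambda>i. axis i 1) (\<lambda>i. - axis i 1) :: 'n::finite + 'n \<Rightarrow> real ^ 'n"
  "case_sum (\<lambda>_. 1) (\<lambda>_. 0)" for k
proof unfold_locales
  have "{x :: real ^ 'n. (\<Sum>i\<in>UNIV. x $ i) = real k} = {x. 1 \<bullet> x = real k}"
    by (simp add: inner_vec_def)
  then show "affine {x :: real ^ 'n. (\<Sum>i\<in>UNIV. x $ i) = real k}"
    by (simp add: affine_hyperplane)
qed

lemma hs_pset: "hs.pset k = hypersimplex k"
  by (auto simp: hs.pset_def hypersimplex_def inner_axis' split: sum.splits)

text \<open>The index \<open>Inl i\<close> stands for the bound 1 and \<open>Inr i\<close> for the
  bound 0, so tight sets are pairs of coordinate sets.\<close>

lemma hs_active: "hs.active x = {i. x $ i = 1} <+> {i. x $ i = 0}"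
proof (rule set_eqI)
  show "q \<in> hs.active x \<longleftrightarrow> q \<in> {i. x $ i = 1} <+> {i. x $ i = 0}" for q
    by (cases q) (auto simp: hs.active_def inner_axis')
qed

lemma Plus_eq_iff: "A <+> B = C <+> D \<longleftrightarrow> A = C \<and> B = D"
  by (auto simp: Plus_def set_eq_iff image_iff)

lemma hs_cell: "hs.cell k (A <+> B) = hcell k A B"
  by (auto simp: hs.cell_def hcell_def hs_pset hs_active Plus_eq_iff)

lemma Plus_exhaust: "\<exists>A B. I = A <+> B"
proof (intro exI set_eqI)
  show "q \<in> I \<longleftrightarrow> q \<in> Inl -` I <+> Inr -` I" for q
    by (cases q) auto
qed

lemma sum_Plus_pairs:
  "(\<Sum>I | P I. g I) = (\<Sum>(A, B) | P (A <+> B). g (A <+> B))"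
proof -
  have "bij_betw (\<lambda>(A, B). A <+> B) {(A, B). P (A <+> B)} {I. P I}"
    unfolding bij_betw_def
  proof
    show "(\<lambda>(A, B). A <+> B) ` {(A, B). P (A <+> B)} = {I. P I}"
    proof safe
      show "I \<in> (\<lambda>(A, B). A <+> B) ` {(A, B). P (A <+> B)}" if "P I" for I
        using Plus_exhaust[of I] that by auto
    qed
  qed (auto simp: inj_on_def Plus_eq_iff)
  from sum.reindex_bij_betw[OF this, of g] show ?thesis
    by (simp add: case_prod_unfold)
qed

lemma aff_dim_coordinate_flat:
  fixes v :: "real ^ 'n::finite"
  shows "aff_dim {x. \<forall>i\<in>E. x $ i = v $ i} = int (CARD('n) - card E)"
proof -
  have "{x. \<forall>i\<in>E. x $ i = v $ i} = (+) v ` {x :: real ^ 'n. \<forall>i. i \<notin> -E \<longrightarrow> x $ i = 0}"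
  proof (rule set_eqI)
    fix x
    show "x \<in> {x. \<forall>i\<in>E. x $ i = v $ i} \<longleftrightarrow> x \<in> (+) v ` {x. \<forall>i. i \<notin> -E \<longrightarrow> x $ i = 0}"
      by (auto simp: image_iff intro!: exI[of _ "x - v"])
  qed
  moreover have "subspace {x :: real ^ 'n. \<forall>i. i \<notin> -E \<longrightarrow> x $ i = 0}"
    by (auto simp: subspace_def)
  then have "aff_dim {x :: real ^ 'n. \<forall>i. i \<notin> -E \<longrightarrow> x $ i = 0} = card (-E)"
    by (simp only: aff_dim_subspace dim_substandard_cart flip: dim_vec_eq)
  ultimately show ?thesis
    by (simp add: aff_dim_translation_eq Compl_eq_Diff_UNIV card_Diff_subset)
qed

lemma aff_dim_hcell:
  fixes A B :: "'n::finite set"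
  assumes AB: "A \<inter> B = {}" and k: "card A < k" "k + card B < CARD('n)"
  shows "nat (aff_dim (hcell k A B)) = CARD('n) - 1 - card A - card B"
proof -
  \<comment> \<open>This vector has a double use: it prescribes the fixed coordinates, and it is a
    point of \<open>?K\<close> off the hyperplane, its coordinate sum being
    \<open>card A < k\<close>. Hence the sum condition costs exactly one dimension.\<close>
  let ?v = "(\<chi> i. if i \<in> A then 1 else 0) :: real ^ 'n"
  let ?K = "{x. \<forall>i\<in>A \<union> B. x $ i = ?v $ i}"
  have ne: "hcell k A B \<noteq> {}" using assms hcell_nonempty_iff by blast
  have flat: "hs.flat k (A <+> B) = ?K \<inter> {x. 1 \<bullet> x = real k}"
  proof -
    have "1 \<bullet> x = (\<Sum>i\<in>UNIV. x $ i)" for x :: "real ^ 'n" by (simp add: inner_vec_def)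
    then show ?thesis
      using AB by (auto simp: hs.flat_def inner_axis' Plus_def ball_Un)
  qed
  have aff: "affine ?K"
    by (auto simp: affine_def algebra_simps)
  have "aff_dim (hcell k A B) = aff_dim (?K \<inter> {x. 1 \<bullet> x = real k})"
    using hs.aff_dim_cell[of k "A <+> B"] ne unfolding hs_cell flat by blast
  also have "\<dots> = aff_dim ?K - 1"
  proof -
    have ne': "?K \<inter> {x. 1 \<bullet> x = real k} \<noteq> {}"
      using ne hs.cell_subset[of k "A <+> B"] unfolding hs_cell flat by blast
    have "?v \<in> ?K" by auto
    moreover have "1 \<bullet> ?v \<noteq> real k" using k by (simp add: inner_vec_def sum.If_cases)
    ultimately have nsub: "\<not> ?K \<subseteq> {x. 1 \<bullet> x = real k}" by blast
    show ?thesis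
      unfolding aff_dim_affine_Int_hyperplane[OF aff] if_not_P[OF ne'] if_not_P[OF nsub] ..
  qed
  also have "\<dots> = int (CARD('n) - card (A \<union> B)) - 1"
    by (simp only: aff_dim_coordinate_flat)
  finally show ?thesis using AB k by (simp add: card_Un_disjoint)
qed

section \<open>Counting pairs of disjoint sets\<close>

text \<open>Choose the \<open>i\<close> elements first and then \<open>j\<close> of the remaining
  \<open>N - i\<close>; this product is what nested sums over disjoint sets produce.\<close>

lemma multinom_eq:
  assumes "i + j \<le> N"
  shows "multinom N i j = (N choose i) * ((N - i) choose j)"
proof -
  have "fact i * (fact j * fact (N - i - j)) * ((N choose i) * ((N - i) choose j)) = (fact N :: nat)"
    using binomial_fact_lemma[of i N] binomial_fact_lemma[of j "N - i"] assms
    by (metis (no_types, lifting) add_leD1 add_le_imp_le_diff mult.assoc mult.commute add.commute)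
  then have "fact N = (N choose i) * ((N - i) choose j) * (fact i * fact j * fact (N - i - j))"
    by (simp add: mult_ac)
  then show ?thesis unfolding multinom_def by simp
qed

lemma sum_Pow_card:
  fixes g :: "nat \<Rightarrow> 'a::comm_semiring_1"
  assumes "finite X"
  shows "(\<Sum>A\<in>Pow X. g (card A)) = (\<Sum>i\<le>card X. of_nat (card X choose i) * g i)"
proof -
  have "(\<Sum>A\<in>Pow X. g (card A)) = (\<Sum>i\<le>card X. \<Sum>A\<in>{A. A \<in> Pow X \<and> card A = i}. g (card A))"
    by (rule sum.group[symmetric]) (use assms in \<open>auto intro: card_mono\<close>)
  also have "\<dots> = (\<Sum>i\<le>card X. of_nat (card X choose i) * g i)"
  proof (rule sum.cong[OF refl])
    fix i
    have "(\<Sum>A\<in>{A. A \<in> Pow X \<and> card A = i}. g (card A)) = (\<Sum>A\<in>{A. A \<subseteq> X \<and> card A = i}. g i)"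
      by (rule sum.cong) auto
    then show "(\<Sum>A\<in>{A. A \<in> Pow X \<and> card A = i}. g (card A)) = of_nat (card X choose i) * g i"
      using n_subsets[OF assms, of i] by simp
  qed
  finally show ?thesis .
qed

definition disjoint_pairs :: "'a set \<Rightarrow> ('a set \<times> 'a set) set" where
  "disjoint_pairs X = {(A, B). A \<subseteq> X \<and> B \<subseteq> X \<and> A \<inter> B = {}}"

text \<open>For fixed \<open>A\<close> the second set runs over all subsets of \<open>X - A\<close>,
  so counting subsets by size twice yields the multinomial weight.\<close>

lemma sum_disjoint_pairs:
  fixes g :: "nat \<Rightarrow> nat \<Rightarrow> 'a::comm_semiring_1"
  assumes X: "finite X"
  shows "(\<Sum>(A, B)\<in>disjoint_pairs X. g (card A) (card B)) =
    (\<Sum>(i, j) | i + j \<le> card X. of_nat (multinom (card X) i j) * g i j)"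
proof -
  have eq: "disjoint_pairs X = Sigma (Pow X) (\<lambda>A. Pow (X - A))"
    by (auto simp: disjoint_pairs_def)
  have "(\<Sum>(A, B)\<in>disjoint_pairs X. g (card A) (card B)) = (\<Sum>A\<in>Pow X. \<Sum>B\<in>Pow (X - A). g (card A) (card B))"
    unfolding eq by (rule sum.Sigma[symmetric]) (use X in auto)
  also have "\<dots> = (\<Sum>A\<in>Pow X. \<Sum>j\<le>card X - card A. of_nat ((card X - card A) choose j) * g (card A) j)"
  proof (rule sum.cong[OF refl])
    fix A assume "A \<in> Pow X"
    then have "card (X - A) = card X - card A"
      using X by (auto intro: card_Diff_subset finite_subset)
    then show "(\<Sum>B\<in>Pow (X - A). g (card A) (card B))
        = (\<Sum>j\<le>card X - card A. of_nat ((card X - card A) choose j) * g (card A) j)"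
      using sum_Pow_card[of "X - A" "g (card A)"] X by simp
  qed
  also have "\<dots> = (\<Sum>i\<le>card X. of_nat (card X choose i)
      * (\<Sum>j\<le>card X - i. of_nat ((card X - i) choose j) * g i j))"
    by (rule sum_Pow_card[OF X])
  also have "\<dots> = (\<Sum>i\<le>card X. \<Sum>j\<le>card X - i. of_nat (multinom (card X) i j) * g i j)"
    by (simp add: sum_distrib_left multinom_eq mult.assoc)
  also have "\<dots> = (\<Sum>(i, j)\<in>Sigma {..card X} (\<lambda>i. {..card X - i}). of_nat (multinom (card X) i j) * g i j)"
    by (rule sum.Sigma) auto
  also have "Sigma {..card X} (\<lambda>i. {..card X - i}) = {(i, j). i + j \<le> card X}"
    by auto
  finally show ?thesis .
qed

lemma finite_nat_pairs: "finite {(i, j). i + j \<le> (N::nat)}"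
  by (rule finite_subset[of _ "{..N} \<times> {..N}"]) auto

text \<open>A disjoint pair is the same as a disjoint pair inside \<open>S\<close> together with one
  inside the complement, and the summand sees only the four cardinalities.\<close>

lemma sum_disjoint_pairs_split:
  fixes g :: "nat \<Rightarrow> nat \<Rightarrow> nat \<Rightarrow> nat \<Rightarrow> 'a::comm_semiring_1"
  fixes S :: "'n::finite set"
  shows "(\<Sum>(A, B)\<in>disjoint_pairs UNIV. g (card (A \<inter> S)) (card (B \<inter> S)) (card (A - S)) (card (B - S))) =
    (\<Sum>(i, j) | i + j \<le> card S. \<Sum>(l, m) | l + m \<le> card (-S).
       of_nat (multinom (card S) i j * multinom (card (-S)) l m) * g i j l m)"
proof -
  have "(\<Sum>(A, B)\<in>disjoint_pairs UNIV. g (card (A \<inter> S)) (card (B \<inter> S)) (card (A - S)) (card (B - S)))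
    = (\<Sum>((A, B), C, D)\<in>disjoint_pairs S \<times> disjoint_pairs (-S). g (card A) (card B) (card C) (card D))"
    by (rule sum.reindex_bij_witness[of _ "\<lambda>((A, B), C, D). (A \<union> C, B \<union> D)"
          "\<lambda>(A, B). ((A \<inter> S, B \<inter> S), A - S, B - S)"])
      (auto simp: disjoint_pairs_def)
  also have "\<dots> = (\<Sum>(A, B)\<in>disjoint_pairs S. \<Sum>(C, D)\<in>disjoint_pairs (-S). g (card A) (card B) (card C) (card D))"
    by (simp add: sum.cartesian_product case_prod_unfold)
  also have "\<dots> = (\<Sum>(A, B)\<in>disjoint_pairs S.
      (\<Sum>(l, m) | l + m \<le> card (-S). of_nat (multinom (card (-S)) l m) * g (card A) (card B) l m))"
    by (subst sum_disjoint_pairs) simp_all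
  also have "\<dots> = (\<Sum>(i, j) | i + j \<le> card S. of_nat (multinom (card S) i j) *
      (\<Sum>(l, m) | l + m \<le> card (-S). of_nat (multinom (card (-S)) l m) * g i j l m))"
    by (rule sum_disjoint_pairs) simp
  also have "\<dots> = (\<Sum>(i, j) | i + j \<le> card S. \<Sum>(l, m) | l + m \<le> card (-S).
       of_nat (multinom (card S) i j * multinom (card (-S)) l m) * g i j l m)"
    by (simp add: sum_distrib_left case_prod_unfold mult.assoc)
  finally show ?thesis .
qed

text \<open>Vertices correspond to the \<open>k\<close>-sets \<open>A\<close>. This counts the
  vertices cut off by the half-space, sorted by \<open>i = card (A \<inter> S)\<close>, and is the
  source of the binomial sum in the theorem.\<close>

lemma card_subsets_split:
  fixes S :: "'n::finite set"
  assumes "r < k"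
  shows "card {A. card A = k \<and> r < card (A \<inter> S)} =
    (\<Sum>i = r + 1..k. (card S choose i) * (card (-S) choose (k - i)))"
proof -
  have "{A. card A = k \<and> r < card (A \<inter> S)} =
      (\<Union>i\<in>{r+1..k}. {A. card (A \<inter> S) = i \<and> card (A - S) = k - i})"
  proof (rule set_eqI)
    fix A :: "'n set"
    have "card A = card (A \<inter> S) + card (A - S)" by (rule card_Int_Diff) simp
    then show "A \<in> {A. card A = k \<and> r < card (A \<inter> S)} \<longleftrightarrow>
        A \<in> (\<Union>i\<in>{r+1..k}. {A. card (A \<inter> S) = i \<and> card (A - S) = k - i})" by auto
  qed
  also have "card \<dots> = (\<Sum>i\<in>{r+1..k}. card {A. card (A \<inter> S) = i \<and> card (A - S) = k - i})"
    by (rule card_UN_disjoint) auto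
  also have "\<dots> = (\<Sum>i\<in>{r+1..k}. (card S choose i) * (card (-S) choose (k - i)))"
  proof (rule sum.cong[OF refl])
    fix i
    have "bij_betw (\<lambda>A. (A \<inter> S, A - S)) {A. card (A \<inter> S) = i \<and> card (A - S) = k - i}
        ({A. A \<subseteq> S \<and> card A = i} \<times> {A. A \<subseteq> -S \<and> card A = k - i})"
    proof (rule bij_betw_byWitness[where f' = "\<lambda>(A, B). A \<union> B"])
      have "(A \<union> B) \<inter> S = A" "(A \<union> B) - S = B" if "A \<subseteq> S" "B \<subseteq> -S" for A B
        using that by auto
      then show "(\<lambda>(A, B). A \<union> B) ` ({A. A \<subseteq> S \<and> card A = i} \<times> {A. A \<subseteq> -S \<and> card A = k - i})
          \<subseteq> {A. card (A \<inter> S) = i \<and> card (A - S) = k - i}" by auto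
    qed auto
    then show "card {A. card (A \<inter> S) = i \<and> card (A - S) = k - i} = (card S choose i) * (card (-S) choose (k - i))"
      by (simp add: bij_betw_same_card card_cartesian_product n_subsets)
  qed
  finally show ?thesis .
qed

section \<open>The \<open>f\<close>-polynomials of the hypersimplex and of its cut\<close>

abbreviation t_pow :: "nat \<Rightarrow> int poly" where
  "t_pow d \<equiv> monom 1 d"

text \<open>The cells that are not vertices.\<close>

definition inner_pairs :: "nat \<Rightarrow> ('n::finite set \<times> 'n set) set" where
  "inner_pairs k = {(A, B). A \<inter> B = {} \<and> card A < k \<and> k + card B < CARD('n)}"

text \<open>Vertices are separated from the other cells because only the latter satisfy the strict
  inequalities behind the dimension formula. \<open>G\<close> is left general: it is used for
  \<open>t_pow d\<close> and for \<open>t_pow d + t_pow (d - 1)\<close>.\<close>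

lemma sum_hcells:
  fixes Q :: "'n::finite set \<Rightarrow> 'n set \<Rightarrow> bool" and G :: "nat \<Rightarrow> 'b::comm_monoid_add"
  shows "(\<Sum>(A, B) | hcell k A B \<noteq> {} \<and> Q A B. G (nat (aff_dim (hcell k A B)))) =
    (\<Sum>A | card A = k \<and> Q A (-A). G 0)
    + (\<Sum>(A, B) | (A, B) \<in> inner_pairs k \<and> Q A B. G (CARD('n) - 1 - card A - card B))"
proof -
  let ?V = "(\<lambda>A. (A, -A)) ` {A. card A = k \<and> Q A (-A)}"
  let ?I = "{(A, B). (A, B) \<in> inner_pairs k \<and> Q A B}"
  let ?G = "\<lambda>(A, B). G (nat (aff_dim (hcell k A B)))"
  have "{(A, B). hcell k A B \<noteq> {} \<and> Q A B} = ?V \<union> ?I"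
  proof (rule set_eqI, clarify)
    fix A B :: "'n set"
    have "A \<inter> B = {} \<and> A \<union> B = UNIV \<longleftrightarrow> B = - A" by auto
    then have "hcell k A B \<noteq> {} \<longleftrightarrow> B = -A \<and> card A = k \<or> (A, B) \<in> inner_pairs k"
      unfolding hcell_nonempty_iff inner_pairs_def by blast
    then show "(A, B) \<in> {(A, B). hcell k A B \<noteq> {} \<and> Q A B} \<longleftrightarrow> (A, B) \<in> ?V \<union> ?I"
      by blast
  qed
  moreover have "?V \<inter> ?I = {}"
    by (auto simp: inner_pairs_def)
  ultimately have "sum ?G {(A, B). hcell k A B \<noteq> {} \<and> Q A B} = sum ?G ?V + sum ?G ?I"
    by (simp add: sum.union_disjoint)
  also have "sum ?G ?V = (\<Sum>A | card A = k \<and> Q A (-A). ?G (A, -A))"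
    by (subst sum.reindex) (auto simp: inj_on_def)
  also have "\<dots> = (\<Sum>A | card A = k \<and> Q A (-A). G 0)"
    by (rule sum.cong) (auto simp: hcell_vertex)
  also have "sum ?G ?I = (\<Sum>(A, B)\<in>?I. G (CARD('n) - 1 - card A - card B))"
    by (rule sum.cong) (auto simp: inner_pairs_def aff_dim_hcell)
  finally show ?thesis .
qed

lemma f_poly_hypersimplex:
  "f_poly (hypersimplex k :: (real ^ 'n::finite) set) = of_nat (CARD('n) choose k)
    + (\<Sum>(A, B)\<in>(inner_pairs k :: ('n set \<times> 'n set) set). t_pow (CARD('n) - 1 - card A - card B))"
proof -
  have "f_poly (hypersimplex k :: (real ^ 'n) set)
      = (\<Sum>I :: ('n + 'n) set | hs.cell k I \<noteq> {}. t_pow (nat (aff_dim (hs.cell k I))))"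
    using hs.f_poly_pset[of k] unfolding hs_pset .
  also have "\<dots> = (\<Sum>(A, B) | hcell k A (B :: 'n set) \<noteq> {} \<and> True. t_pow (nat (aff_dim (hcell k A B))))"
    unfolding sum_Plus_pairs hs_cell by simp
  also have "\<dots> = (\<Sum>A :: 'n set | card A = k \<and> True. t_pow 0)
      + (\<Sum>(A, B) | (A, B) \<in> (inner_pairs k :: ('n set \<times> 'n set) set) \<and> True. t_pow (CARD('n) - 1 - card A - card B))"
    by (rule sum_hcells)
  finally show ?thesis
    using n_subsets[of "UNIV :: 'n set" k] by (simp add: case_prod_unfold)
qed

text \<open>The general half-space formula is applied with the indicator vector of \<open>S\<close>
  as normal. Lost vertices give the constant term, and the two criteria for exceeding and falling
  below \<open>r\<close> describe the remaining lost and crossing cells.\<close>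

lemma f_poly_hypersimplex_cut:
  fixes S :: "'n::finite set"
  assumes "r \<le> k"
  shows "f_poly (hypersimplex k :: (real ^ 'n) set) - f_poly {x \<in> hypersimplex k. (\<Sum>i\<in>S. x $ i) \<le> real r} =
     of_nat (card {A. card A = k \<and> r < card (A \<inter> S)})
     + (\<Sum>(A, B) | (A, B) \<in> inner_pairs k \<and> (r + card (B \<inter> S) < card S \<and> r + card (A - S) < k).
          t_pow (CARD('n) - 1 - card A - card B))
     - (\<Sum>(A, B) | (A, B) \<in> inner_pairs k \<and> ((r + card (B \<inter> S) < card S \<and> r + card (A - S) < k) \<and>
            (k - r + card (B - S) < card (-S) \<and> card (A \<inter> S) < r)).
          t_pow (CARD('n) - 1 - card A - card B) + t_pow (CARD('n) - 1 - card A - card B - 1))"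
proof -
  define c :: "real ^ 'n" where "c = (\<chi> i. if i \<in> S then 1 else 0)"
  have c: "c \<bullet> x = (\<Sum>i\<in>S. x $ i)" for x
    by (simp add: c_def inner_vec_def if_distrib[of "\<lambda>a. a * _"] sum.If_cases cong: if_cong)
  define X where "X A B \<longleftrightarrow> (\<exists>x\<in>hcell k A B. (\<Sum>i\<in>S. x $ i) > real r)" for A B
  define Y where "Y A B \<longleftrightarrow> (\<exists>x\<in>hcell k A B. (\<Sum>i\<in>S. x $ i) < real r)" for A B
  have X_inner: "X A B \<longleftrightarrow> r + card (B \<inter> S) < card S \<and> r + card (A - S) < k"
    if "(A, B) \<in> inner_pairs k" for A B
    unfolding X_def by (rule hcell_exceeds_iff) (use that in \<open>auto simp: inner_pairs_def\<close>)
  have Y_inner: "Y A B \<longleftrightarrow> k - r + card (B - S) < card (-S) \<and> card (A \<inter> S) < r"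
    if "(A, B) \<in> inner_pairs k" for A B
    unfolding Y_def by (rule hcell_below_iff) (use that assms in \<open>auto simp: inner_pairs_def\<close>)
  have X_vertex: "X A (-A) \<longleftrightarrow> r < card (A \<inter> S)" if "card A = k" for A
    using that by (simp add: X_def hcell_vertex sum.If_cases Int_commute)
  have XY_vertex: "\<not> (X A (-A) \<and> Y A (-A))" if "card A = k" for A
    using that by (auto simp: X_def Y_def hcell_vertex)
  let ?G = "\<lambda>d. t_pow d + t_pow (d - 1)"
  have "{x \<in> hypersimplex k. (\<Sum>i\<in>S. x $ i) \<le> real r} = hs.pset k \<inter> {x. c \<bullet> x \<le> real r}"
    by (auto simp: hs_pset c)
  then have "f_poly (hypersimplex k :: (real ^ 'n) set) - f_poly {x \<in> hypersimplex k. (\<Sum>i\<in>S. x $ i) \<le> real r} =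
      (\<Sum>I | \<exists>x\<in>hs.cell k I. c \<bullet> x > r. t_pow (nat (aff_dim (hs.cell k I))))
    - (\<Sum>I | (\<exists>x\<in>hs.cell k I. c \<bullet> x > r) \<and> (\<exists>x\<in>hs.cell k I. c \<bullet> x < r). ?G (nat (aff_dim (hs.cell k I))))"
    using hs.f_poly_diff_halfspace[of k c r] by (simp only: hs_pset)
  also have "\<dots> = (\<Sum>(A, B) | X A B. t_pow (nat (aff_dim (hcell k A B))))
      - (\<Sum>(A, B) | X A B \<and> Y A B. ?G (nat (aff_dim (hcell k A B))))"
    unfolding sum_Plus_pairs hs_cell c X_def Y_def ..
  \<comment> \<open>Nonemptiness follows from \<open>X A B\<close>; it is made explicit to match the
    form of \<open>sum_hcells\<close>.\<close>
  also have "\<dots> = (\<Sum>(A, B) | hcell k A B \<noteq> {} \<and> X A B. t_pow (nat (aff_dim (hcell k A B))))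
      - (\<Sum>(A, B) | hcell k A B \<noteq> {} \<and> (X A B \<and> Y A B). ?G (nat (aff_dim (hcell k A B))))"
  proof -
    have "{(A, B). X A B} = {(A, B). hcell k A B \<noteq> {} \<and> X A B}"
      "{(A, B). X A B \<and> Y A B} = {(A, B). hcell k A B \<noteq> {} \<and> (X A B \<and> Y A B)}"
      by (auto simp: X_def)
    then show ?thesis by (simp only:)
  qed
  also have "\<dots> = (\<Sum>A | card A = k \<and> X A (-A). t_pow 0)
        + (\<Sum>(A, B) | (A, B) \<in> inner_pairs k \<and> X A B. t_pow (CARD('n) - 1 - card A - card B))
      - ((\<Sum>A | card A = k \<and> (X A (-A) \<and> Y A (-A)). ?G 0)
        + (\<Sum>(A, B) | (A, B) \<in> inner_pairs k \<and> (X A B \<and> Y A B). ?G (CARD('n) - 1 - card A - card B)))"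
    by (simp only: sum_hcells[where G = "monom 1"] sum_hcells[where G = ?G])
  also have "(\<Sum>A | card A = k \<and> X A (-A). t_pow 0) = of_nat (card {A. card A = k \<and> r < card (A \<inter> S)})"
  proof -
    have "{A. card A = k \<and> X A (-A)} = {A. card A = k \<and> r < card (A \<inter> S)}" using X_vertex by auto
    then show ?thesis by simp
  qed
  \<comment> \<open>A single point cannot lie strictly on both sides, so the truncated exponent
    \<open>0 - 1\<close> never contributes.\<close>
  also have "(\<Sum>A | card A = k \<and> (X A (-A) \<and> Y A (-A)). ?G 0) = 0"
    using XY_vertex by (intro sum.neutral) blast
  also have "{(A, B). (A, B) \<in> inner_pairs k \<and> X A B} =
      {(A, B). (A, B) \<in> inner_pairs k \<and> (r + card (B \<inter> S) < card S \<and> r + card (A - S) < k)}"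
    using X_inner by auto
  also have "{(A, B). (A, B) \<in> inner_pairs k \<and> (X A B \<and> Y A B)} =
      {(A, B). (A, B) \<in> inner_pairs k \<and> ((r + card (B \<inter> S) < card S \<and> r + card (A - S) < k) \<and>
            (k - r + card (B - S) < card (-S) \<and> card (A \<inter> S) < r))}"
    using X_inner Y_inner by auto
  finally show ?thesis by simp
qed

section \<open>From sums over cells to sums over cardinalities\<close>

lemma sum_inner_pairs:
  fixes g :: "nat \<Rightarrow> nat \<Rightarrow> nat \<Rightarrow> nat \<Rightarrow> 'a::comm_semiring_1" and S :: "'n::finite set"
  shows "(\<Sum>(A, B) | (A, B) \<in> inner_pairs k \<and> Q (card (A \<inter> S)) (card (B \<inter> S)) (card (A - S)) (card (B - S)).
      g (card (A \<inter> S)) (card (B \<inter> S)) (card (A - S)) (card (B - S))) =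
    (\<Sum>(i, j) | i + j \<le> card S. \<Sum>(l, m) | l + m \<le> card (-S).
       of_nat (multinom (card S) i j * multinom (card (-S)) l m) *
       (if i + l < k \<and> k + j + m < CARD('n) \<and> Q i j l m then g i j l m else 0))"
proof -
  have split: "card A = card (A \<inter> S) + card (A - S)" for A :: "'n set"
    by (rule card_Int_Diff) simp
  let ?C = "\<lambda>i j l m. i + l < k \<and> k + j + m < CARD('n) \<and> Q i j l m"
  \<comment> \<open>Splitting \<open>card A\<close> and \<open>card B\<close> along \<open>S\<close>
    expresses membership in \<open>inner_pairs k\<close> through the four cardinalities as
    well.\<close>
  have "{(A, B). (A, B) \<in> inner_pairs k \<and> Q (card (A \<inter> S)) (card (B \<inter> S)) (card (A - S)) (card (B - S))}
      = {(A, B) \<in> disjoint_pairs UNIV. ?C (card (A \<inter> S)) (card (B \<inter> S)) (card (A - S)) (card (B - S))}"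
  proof (rule set_eqI, clarify)
    fix A B :: "'n set"
    show "(A, B) \<in> {(A, B). (A, B) \<in> inner_pairs k \<and> Q (card (A \<inter> S)) (card (B \<inter> S)) (card (A - S)) (card (B - S))} \<longleftrightarrow>
       (A, B) \<in> {(A, B) \<in> disjoint_pairs UNIV. ?C (card (A \<inter> S)) (card (B \<inter> S)) (card (A - S)) (card (B - S))}"
      using split[of A] split[of B] by (auto simp: inner_pairs_def disjoint_pairs_def)
  qed
  then have "(\<Sum>(A, B) | (A, B) \<in> inner_pairs k \<and> Q (card (A \<inter> S)) (card (B \<inter> S)) (card (A - S)) (card (B - S)).
      g (card (A \<inter> S)) (card (B \<inter> S)) (card (A - S)) (card (B - S))) =
    (\<Sum>(A, B)\<in>disjoint_pairs UNIV. if ?C (card (A \<inter> S)) (card (B \<inter> S)) (card (A - S)) (card (B - S))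
      then g (card (A \<inter> S)) (card (B \<inter> S)) (card (A - S)) (card (B - S)) else 0)"
    by (simp add: sum.inter_filter case_prod_unfold)
  also have "\<dots> = (\<Sum>(i, j) | i + j \<le> card S. \<Sum>(l, m) | l + m \<le> card (-S).
       of_nat (multinom (card S) i j * multinom (card (-S)) l m) * (if ?C i j l m then g i j l m else 0))"
    by (rule sum_disjoint_pairs_split)
  finally show ?thesis .
qed

lemma p'_poly_eq:
  assumes "CARD('h::finite) = h"
  shows "p'_poly TYPE('h) r = (\<Sum>(i, j) | i + j \<le> h. of_nat (multinom h i j) *
    (if i < r \<and> r + j < h then t_pow (h - 1 - i - j) else 0))"
proof -
  have "p'_poly TYPE('h) r = (\<Sum>(A, B)\<in>(inner_pairs r :: ('h set \<times> 'h set) set). t_pow (CARD('h) - 1 - card A - card B))"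
    unfolding p'_poly_def f_poly_hypersimplex by simp
  also have "(inner_pairs r :: ('h set \<times> 'h set) set) =
      {(A, B) \<in> disjoint_pairs UNIV. card A < r \<and> r + card B < CARD('h)}"
    by (auto simp: inner_pairs_def disjoint_pairs_def)
  also have "(\<Sum>(A, B)\<in>\<dots>. t_pow (CARD('h) - 1 - card A - card B)) =
      (\<Sum>(A, B)\<in>disjoint_pairs (UNIV :: 'h set). if card A < r \<and> r + card B < CARD('h)
         then t_pow (CARD('h) - 1 - card A - card B) else 0)"
    unfolding case_prod_unfold prod.collapse by (rule sum.inter_filter) simp
  also have "\<dots> = (\<Sum>(i, j) | i + j \<le> CARD('h). of_nat (multinom CARD('h) i j) *
    (if i < r \<and> r + j < CARD('h) then t_pow (CARD('h) - 1 - i - j) else 0))"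
    by (rule sum_disjoint_pairs) simp
  finally show ?thesis unfolding assms .
qed

lemma mem_up_to [simp]: "i \<in> up_to z \<longleftrightarrow> int i \<le> z"
  by (simp add: up_to_def)

lemma finite_up_to [simp]: "finite (up_to z)"
  by (rule finite_subset[of _ "{..nat z}"]) auto

text \<open>The nested upper limits together amount to one system of inequalities: the multinomial
  ranges, the non-vertex conditions, and the conditions for exceeding \<open>r\<close>. The integer
  limits in \<open>up_to\<close> make negative ones empty, matching the strict inequalities between
  naturals.\<close>

lemma p_poly_eq:
  assumes "h \<le> n"
  shows "p_poly r k h n = (\<Sum>(i, j) | i + j \<le> h. \<Sum>(l, m) | l + m \<le> n - h.
       of_nat (multinom h i j * multinom (n - h) l m) *
       (if i + l < k \<and> k + j + m < n \<and> (r + j < h \<and> r + l < k) then t_pow (n - 1 - (i + l) - (j + m)) else 0))"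
proof -
  let ?P = "{(i, j). i + j \<le> h} \<times> {(l, m). l + m \<le> n - h}"
  let ?c = "\<lambda>((i, j), l, m). i + l < k \<and> k + j + m < n \<and> (r + j < h \<and> r + l < k)"
  let ?f = "\<lambda>i j l m. monom (int (multinom h i j * multinom (n - h) l m)) (n - 1 - i - j - l - m)"
  have "p_poly r k h n = (\<Sum>(j, i, l, m)\<in>(SIGMA j:up_to (int h - int r - 1).
      SIGMA i:up_to (min (int h - int j) (int k - 1)).
      SIGMA l:up_to (min (int k - int i - 1) (int k - int r - 1)).
      up_to (min (int n - int h - int l) (int n - int k - int j - 1))). ?f i j l m)"
    unfolding p_poly_def by (simp add: sum.Sigma)
  also have "\<dots> = (\<Sum>((i, j), l, m) | ((i, j), l, m) \<in> ?P \<and> ?c ((i, j), l, m). ?f i j l m)"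
    by (rule sum.reindex_bij_witness[of _ "\<lambda>((i, j), l, m). (j, i, l, m)" "\<lambda>(j, i, l, m). ((i, j), l, m)"])
      (use assms in auto)
  also have "\<dots> = (\<Sum>x\<in>{x \<in> ?P. ?c x}. (\<lambda>((i, j), l, m). ?f i j l m) x)"
    by (rule sum.cong) auto
  also have "\<dots> = (\<Sum>x\<in>?P. if ?c x then (\<lambda>((i, j), l, m). ?f i j l m) x else 0)"
    by (rule sum.inter_filter) (intro finite_cartesian_product finite_nat_pairs)
  also have "\<dots> = (\<Sum>p | case p of (i, j) \<Rightarrow> i + j \<le> h. \<Sum>q | case q of (l, m) \<Rightarrow> l + m \<le> n - h.
      if ?c (p, q) then (\<lambda>((i, j), l, m). ?f i j l m) (p, q) else 0)"
    unfolding sum.cartesian_product by (rule sum.cong) (auto simp only: split_beta mem_Collect_eq prod.collapse)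
  also have "\<dots> = (\<Sum>(i, j) | i + j \<le> h. \<Sum>(l, m) | l + m \<le> n - h.
       of_nat (multinom h i j * multinom (n - h) l m) *
       (if i + l < k \<and> k + j + m < n \<and> (r + j < h \<and> r + l < k) then t_pow (n - 1 - (i + l) - (j + m)) else 0))"
  proof -
    have "(if c then monom (int a) (n - 1 - i - j - l - m) else 0) =
        of_nat a * (if c then t_pow (n - 1 - (i + l) - (j + m)) else 0)" for a i j l m c
      by (simp add: of_nat_poly smult_monom diff_diff_left add_ac)
    then show ?thesis
      unfolding case_prod_unfold fst_conv snd_conv by (simp only:)
  qed
  finally show ?thesis .
qed

lemma t_pow_add: "t_pow a * t_pow b * [:1, 1:] = t_pow (a + b + 1) + t_pow (a + b)"
proof -
  have "[:1, 1:] = t_pow 1 + t_pow 0" by (simp add: monom_altdef)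
  then show ?thesis by (simp only: distrib_left mult_monom) simp
qed

text \<open>A cell crosses the hyperplane exactly when its parts in the two blocks of coordinates
  are non-vertex cells for \<open>r\<close> and \<open>k - r\<close>; these two conditions imply the
  non-vertex condition for \<open>k\<close>. Its section has the sum of the two dimensions, so the
  factor \<open>1 + t\<close> accounts for the section and the cell.\<close>

lemma p'_poly_prod:
  assumes "CARD('h::finite) = h" "CARD('m::finite) = n - h" "r \<le> k" "h \<le> n"
  shows "p'_poly TYPE('h) r * p'_poly TYPE('m) (k - r) * [:1, 1:] =
    (\<Sum>(i, j) | i + j \<le> h. \<Sum>(l, m) | l + m \<le> n - h.
       of_nat (multinom h i j * multinom (n - h) l m) *
       (if i + l < k \<and> k + j + m < n \<and> ((r + j < h \<and> r + l < k) \<and> (k - r + m < n - h \<and> i < r))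
        then t_pow (n - 1 - (i + l) - (j + m)) + t_pow (n - 1 - (i + l) - (j + m) - 1) else 0))"
proof -
  let ?a = "\<lambda>i j. if i < r \<and> r + j < h then t_pow (h - 1 - i - j) else 0"
  let ?b = "\<lambda>l m. if l < k - r \<and> k - r + m < n - h then t_pow (n - h - 1 - l - m) else 0"
  have *: "?a i j * ?b l m * [:1, 1:] =
      (if i + l < k \<and> k + j + m < n \<and> ((r + j < h \<and> r + l < k) \<and> (k - r + m < n - h \<and> i < r))
        then t_pow (n - 1 - (i + l) - (j + m)) + t_pow (n - 1 - (i + l) - (j + m) - 1) else 0)"
    if "i + j \<le> h" "l + m \<le> n - h" for i j l m
  proof (cases "(i < r \<and> r + j < h) \<and> (l < k - r \<and> k - r + m < n - h)")
    case True
    then have a: "?a i j = t_pow (h - 1 - i - j)" and b: "?b l m = t_pow (n - h - 1 - l - m)"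
      by (simp_all only: if_True simp_thms)
    \<comment> \<open>The \<open>+ 1\<close> arises because each block loses a dimension to its own
      sum condition, while the whole cell satisfies only one. The strict bounds ensure that no
      subtraction is truncated.\<close>
    have d: "n - 1 - (i + l) - (j + m) = (h - 1 - i - j) + (n - h - 1 - l - m) + 1"
      using True that assms(3,4) by auto
    have C: "i + l < k \<and> k + j + m < n \<and> ((r + j < h \<and> r + l < k) \<and> (k - r + m < n - h \<and> i < r))"
      using True assms(3,4) by auto
    show ?thesis
      unfolding a b if_P[OF C] d t_pow_add by (simp only: diff_add_inverse2)
  next
    case False
    then have "\<not> (i < r \<and> r + j < h) \<or> \<not> (l < k - r \<and> k - r + m < n - h)" by blast
    then have ab: "?a i j * ?b l m = 0" by (elim disjE) (simp_all only: if_False mult_zero_left mult_zero_right)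
    have "l < k - r \<longleftrightarrow> r + l < k" using assms(3) by arith
    with False have C: "\<not> (i + l < k \<and> k + j + m < n \<and> ((r + j < h \<and> r + l < k) \<and> (k - r + m < n - h \<and> i < r)))"
      by blast
    show ?thesis unfolding ab if_not_P[OF C] by simp
  qed
  have "p'_poly TYPE('h) r * p'_poly TYPE('m) (k - r) * [:1, 1:] =
    (\<Sum>(i, j) | i + j \<le> h. \<Sum>(l, m) | l + m \<le> n - h.
      (of_nat (multinom h i j) * ?a i j) * (of_nat (multinom (n - h) l m) * ?b l m) * [:1, 1:])"
    unfolding p'_poly_eq[OF assms(1)] p'_poly_eq[OF assms(2)] sum_product
    unfolding sum_distrib_right case_prod_unfold ..
  also have "\<dots> = (\<Sum>(i, j) | i + j \<le> h. \<Sum>(l, m) | l + m \<le> n - h.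
      of_nat (multinom h i j * multinom (n - h) l m) * (?a i j * ?b l m * [:1, 1:]))"
  proof -
    have "(x * a) * (y * b) * c = (x * y) * (a * b * c)" for x y a b c :: "int poly"
      by (simp only: mult_ac)
    then show ?thesis by (simp only: of_nat_mult)
  qed
  also have "\<dots> = (\<Sum>(i, j) | i + j \<le> h. \<Sum>(l, m) | l + m \<le> n - h.
       of_nat (multinom h i j * multinom (n - h) l m) *
       (if i + l < k \<and> k + j + m < n \<and> ((r + j < h \<and> r + l < k) \<and> (k - r + m < n - h \<and> i < r))
        then t_pow (n - 1 - (i + l) - (j + m)) + t_pow (n - 1 - (i + l) - (j + m) - 1) else 0))"
    unfolding case_prod_unfold
  proof (intro sum.cong refl arg_cong2[where f = times])
    fix p q assume "p \<in> {p. fst p + snd p \<le> h}" "q \<in> {q. fst q + snd q \<le> n - h}"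
    then show "?a (fst p) (snd p) * ?b (fst q) (snd q) * [:1, 1:] =
      (if fst p + fst q < k \<and> k + snd p + snd q < n \<and> ((r + snd p < h \<and> r + fst q < k) \<and> (k - r + snd q < n - h \<and> fst p < r))
        then t_pow (n - 1 - (fst p + fst q) - (snd p + snd q)) + t_pow (n - 1 - (fst p + fst q) - (snd p + snd q) - 1) else 0)"
      by (intro *) auto
  qed
  finally show ?thesis .
qed

theorem proposition2p8:
  fixes r k h n :: nat
    and e :: "nat \<Rightarrow> 'n::finite"
  assumes "0 < r" "r < k" "k < n" "r < h" "h < n"
    and "CARD('n) = n"
    and "CARD('h::finite) = h"
    and "CARD('m::finite) = n - h"
    and "bij_betw e {1..n} UNIV"
  shows "u_poly e r k h =
      p_poly r k h n
      - p'_poly TYPE('h) r * p'_poly TYPE('m) (k - r) * [:1, 1:]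
      + of_nat (\<Sum>i = r + 1..k. (h choose i) * ((n - h) choose (k - i)))"
proof -
  define S where "S = e ` {1..h}"
  have inj: "inj_on e {1..h}"
    by (rule inj_on_subset[of e "{1..n}"]) (use assms(5,9) in \<open>auto simp: bij_betw_def\<close>)
  have S: "card S = h" "card (-S) = n - h"
    using card_image[OF inj] assms(6) by (simp_all add: S_def Compl_eq_Diff_UNIV card_Diff_subset)
  have "schubert_split_polytope e r k h = {x \<in> hypersimplex k. (\<Sum>i\<in>S. x $ i) \<le> real r}"
    unfolding schubert_split_polytope_def S_def by (simp only: sum.reindex[OF inj] o_def)
  then have u: "u_poly e r k h = f_poly (hypersimplex k :: (real ^ 'n) set) - f_poly {x \<in> hypersimplex k. (\<Sum>i\<in>S. x $ i) \<le> real r}"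
    by (simp add: u_poly_def)
  \<comment> \<open>The exponent has to be written in the four cardinalities before
    \<open>sum_inner_pairs\<close> can apply.\<close>
  have split: "n - 1 - card A - card B =
      n - 1 - (card (A \<inter> S) + card (A - S)) - (card (B \<inter> S) + card (B - S))" for A B :: "'n set"
    using card_Int_Diff[of A S] card_Int_Diff[of B S] by simp
  have "r \<le> k" "h \<le> n" using assms by auto
  show ?thesis
    unfolding u f_poly_hypersimplex_cut[OF \<open>r \<le> k\<close>] card_subsets_split[OF \<open>r < k\<close>] assms(6) split
    \<comment> \<open>Both remaining sums over non-vertex cells become sums over cardinalities: the
      first is \<open>p_poly\<close>, the second the product of the two \<open>p'_poly\<close> with
      \<open>1 + t\<close>. \<open>Q\<close> and \<open>g\<close> are spelled out because they are
      higher-order parameters.\<close>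
    unfolding
      sum_inner_pairs[where Q = "\<lambda>i j l m. r + j < card S \<and> r + l < k"
        and g = "\<lambda>i j l m. t_pow (n - 1 - (i + l) - (j + m))"]
      sum_inner_pairs[where Q = "\<lambda>i j l m. (r + j < card S \<and> r + l < k) \<and> (k - r + m < card (-S) \<and> i < r)"
        and g = "\<lambda>i j l m. t_pow (n - 1 - (i + l) - (j + m)) + t_pow (n - 1 - (i + l) - (j + m) - 1)"]
    unfolding S assms(6) p_poly_eq[OF \<open>h \<le> n\<close>] p'_poly_prod[OF assms(7,8) \<open>r \<le> k\<close> \<open>h \<le> n\<close>]
    by simp
qed

end
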